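(* Let $\mathcal A\in\mathbb{R}^{m\times n}$ with transpose $\mathcal A^*$, let $c\in\mathbb{R}^n$, let $h:\mathbb{R}^m\to\mathbb{R}$ be convex, strongly convex and $C^2$-smooth, and let $p:\mathbb{R}^n\to\mathbb{R}\cup\{\infty\}$ be proper, l.s.c. and convex. Consider the primal problem $$(\mathbf P)\quad\text{minimize } h(\mathcal Ax)-\langle c,x\rangle+p(x)\ \text{ over }x\in\mathbb{R}^n$$ and the dual problem $$(\mathbf D)\quad\text{minimize } h^*(y)+p^*(z)\ \text{ subject to }\mathcal A^*y+z=c,\ (y,z)\in\mathbb{R}^m\times\mathbb{R}^n,$$ where $h^*,p^*$ are the Fenchel conjugates. Suppose that $(\mathbf P)$ admits an optimal solution. Then for any infinite sequence $\{(y^k,z^k,x^k)\}$ generated by Algorithm CNAL (described in the context), $\{x^k\}$ converges to an optimal solution of $(\mathbf P)$ and $\{(y^k,z^k)\}$ converges to an optimal solution of $(\mathbf D)$.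
   Context: For $\sigma>0$ the augmented Lagrangian of $(\mathbf D)$ is $$\mathcal L_\sigma(y,z;x)=h^*(y)+p^*(z)-\langle x,\mathcal A^*y+z-c\rangle+\tfrac\sigma2\|\mathcal A^*y+z-c\|^2.$$ Algorithm CNAL. Input: $\sigma_0>0$, $(y^0,z^0,x^0)\in\mathbb{R}^m\times\mathrm{dom}\,p^*\times\mathbb{R}^n$. For $k=0,1,\ldots$: (1) Compute an approximate minimizer $(y^{k+1},z^{k+1})$ of $\Psi_k(y,z):=\mathcal L_{\sigma_k}(y,z;x^k)$ (by means of an inner coderivative-based Newton solver), stopped according to the criterion $$\Psi_k(y^{k+1},z^{k+1})-\inf\Psi_k\le\frac{\epsilon_k^2}{2\sigma_k},\qquad\text{where }\epsilon_k\ge0,\ \sum_{k=0}^\infty\epsilon_k<\infty.$$ (2) Set $x^{k+1}=x^k-\sigma_k(\mathcal A^*y^{k+1}+z^{k+1}-c)$ and update $\sigma_{k+1}\ge\sigma_k$, with $\sigma_k\uparrow\sigma_\infty\le\infty$. *)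

theory Defs
  imports "HOL-Analysis.Analysis"
begin

definition strongly_convex :: "('a::real_normed_vector \<Rightarrow> real) \<Rightarrow> bool" where
  "strongly_convex f \<longleftrightarrow>
     (\<exists>\<mu>>0. \<forall>x y. \<forall>t\<in>{0..1}.
        f ((1 - t) *\<^sub>R x + t *\<^sub>R y)
          \<le> (1 - t) * f x + t * f y - \<mu> / 2 * t * (1 - t) * (norm (x - y))\<^sup>2)"

definition C2_smooth :: "('a::real_normed_vector \<Rightarrow> real) \<Rightarrow> bool" where
  "C2_smooth f \<longleftrightarrow>
     (\<exists>(f' :: 'a \<Rightarrow> 'a \<Rightarrow>\<^sub>L real) (f'' :: 'a \<Rightarrow> 'a \<Rightarrow>\<^sub>L ('a \<Rightarrow>\<^sub>L real)).
        (\<forall>x. (f has_derivative blinfun_apply (f' x)) (at x)) \<and>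
        (\<forall>x. (f' has_derivative blinfun_apply (f'' x)) (at x)) \<and>
        continuous_on UNIV f'')"

definition proper_fun :: "('a \<Rightarrow> ereal) \<Rightarrow> bool" where
  "proper_fun f \<longleftrightarrow> (\<forall>x. f x \<noteq> -\<infinity>) \<and> (\<exists>x. f x \<noteq> \<infinity>)"

definition lsc_fun :: "('a::topological_space \<Rightarrow> ereal) \<Rightarrow> bool" where
  "lsc_fun f \<longleftrightarrow> (\<forall>x. f x \<le> Liminf (at x) f)"

text \<open>Only meaningful for functions that never take the value \<open>-\<infinity>\<close>,
  because \<open>\<infinity> + -\<infinity> = \<infinity>\<close> in \<^typ>\<open>ereal\<close>.\<close>

definition convex_ereal :: "('a::real_vector \<Rightarrow> ereal) \<Rightarrow> bool" where
  "convex_ereal f \<longleftrightarrow>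
     (\<forall>x y. \<forall>t\<in>{0<..<1}.
        f ((1 - t) *\<^sub>R x + t *\<^sub>R y) \<le> ereal (1 - t) * f x + ereal t * f y)"

definition edom :: "('a \<Rightarrow> ereal) \<Rightarrow> 'a set" where
  "edom f = {x. f x < \<infinity>}"

definition fenchel_conjugate :: "('a::real_inner \<Rightarrow> ereal) \<Rightarrow> 'a \<Rightarrow> ereal" where
  "fenchel_conjugate f y = (SUP x. ereal (y \<bullet> x) - f x)"

text \<open>An optimal solution has to have a finite objective value: a feasible point is not
  optimal merely because the objective is identically \<open>\<infinity>\<close> on the feasible set.\<close>

definition optimal_solution :: "('a \<Rightarrow> ereal) \<Rightarrow> ('a \<Rightarrow> bool) \<Rightarrow> 'a \<Rightarrow> bool" where
  "optimal_solution f feasible x \<longleftrightarrow> is_arg_min f feasible x \<and> \<bar>f x\<bar> \<noteq> \<infinity>"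

definition primal_objective ::
  "(real^'m \<Rightarrow> real) \<Rightarrow> real^'n^'m \<Rightarrow> real^'n \<Rightarrow> (real^'n \<Rightarrow> ereal) \<Rightarrow> real^'n \<Rightarrow> ereal" where
  "primal_objective h A c p x = ereal (h (A *v x) - c \<bullet> x) + p x"

definition primal_optimal ::
  "(real^'m \<Rightarrow> real) \<Rightarrow> real^'n^'m \<Rightarrow> real^'n \<Rightarrow> (real^'n \<Rightarrow> ereal) \<Rightarrow> real^'n \<Rightarrow> bool" where
  "primal_optimal h A c p x \<longleftrightarrow> optimal_solution (primal_objective h A c p) (\<lambda>_. True) x"

definition dual_objective ::
  "(real^'m \<Rightarrow> real) \<Rightarrow> (real^'n \<Rightarrow> ereal) \<Rightarrow> (real^'m) \<times> (real^'n) \<Rightarrow> ereal" where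
  "dual_objective h p = (\<lambda>(y, z).
     fenchel_conjugate (\<lambda>u. ereal (h u)) y + fenchel_conjugate p z)"

definition dual_optimal ::
  "(real^'m \<Rightarrow> real) \<Rightarrow> real^'n^'m \<Rightarrow> real^'n \<Rightarrow> (real^'n \<Rightarrow> ereal) \<Rightarrow>
   (real^'m) \<times> (real^'n) \<Rightarrow> bool" where
  "dual_optimal h A c p yz \<longleftrightarrow>
     optimal_solution (dual_objective h p) (\<lambda>(y, z). transpose A *v y + z = c) yz"

definition augmented_Lagrangian ::
  "(real^'m \<Rightarrow> real) \<Rightarrow> real^'n^'m \<Rightarrow> real^'n \<Rightarrow> (real^'n \<Rightarrow> ereal) \<Rightarrow>
   real \<Rightarrow> real^'m \<Rightarrow> real^'n \<Rightarrow> real^'n \<Rightarrow> ereal" where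
  "augmented_Lagrangian h A c p \<sigma> y z x =
     fenchel_conjugate (\<lambda>u. ereal (h u)) y + fenchel_conjugate p z
     - ereal (x \<bullet> (transpose A *v y + z - c))
     + ereal (\<sigma> / 2 * (norm (transpose A *v y + z - c))\<^sup>2)"

text \<open>Sequences generated by the augmented Lagrangian method. The inner solver enters only
  through the stopping criterion that its output satisfies.\<close>

definition CNAL_sequence ::
  "(real^'m \<Rightarrow> real) \<Rightarrow> real^'n^'m \<Rightarrow> real^'n \<Rightarrow> (real^'n \<Rightarrow> ereal) \<Rightarrow>
   (nat \<Rightarrow> real) \<Rightarrow> ereal \<Rightarrow> (nat \<Rightarrow> real) \<Rightarrow>
   (nat \<Rightarrow> real^'m) \<Rightarrow> (nat \<Rightarrow> real^'n) \<Rightarrow> (nat \<Rightarrow> real^'n) \<Rightarrow> bool" where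
  "CNAL_sequence h A c p \<sigma> \<sigma>_inf \<epsilon> y z x \<longleftrightarrow>
     \<sigma> 0 > 0 \<and> z 0 \<in> edom (fenchel_conjugate p) \<and>
     (\<forall>k. \<epsilon> k \<ge> 0) \<and> summable \<epsilon> \<and>
     (\<forall>k. augmented_Lagrangian h A c p (\<sigma> k) (y (Suc k)) (z (Suc k)) (x k)
            - (INF (v, w). augmented_Lagrangian h A c p (\<sigma> k) v w (x k))
          \<le> ereal ((\<epsilon> k)\<^sup>2 / (2 * \<sigma> k))) \<and>
     (\<forall>k. x (Suc k) = x k - \<sigma> k *\<^sub>R (transpose A *v y (Suc k) + z (Suc k) - c)) \<and>
     (\<forall>k. \<sigma> (Suc k) \<ge> \<sigma> k) \<and> (\<lambda>k. ereal (\<sigma> k)) \<longlonglongrightarrow> \<sigma>_inf"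

end

theory Submission
  imports Defs
begin

text \<open>
  Write \<open>f\<close> for the primal objective and let \<open>w\<^sub>k\<close> be the proximal point of \<open>x\<^sub>k\<close>, the minimizer of
  \<open>f u + |u - x\<^sub>k|\<^sup>2 / (2 \<sigma>\<^sub>k)\<close>. First-order optimality at \<open>w\<^sub>k\<close> yields subgradients at which the
  augmented Lagrangian takes the value \<open>- f w\<^sub>k - |x\<^sub>k - w\<^sub>k|\<^sup>2 / (2 \<sigma>\<^sub>k)\<close>, which by the
  Fenchel--Young inequality is its infimum. The same inequality with its square term turns the stopping criterion into \<open>|x\<^sub>k\<^sub>+\<^sub>1 - w\<^sub>k| \<le> \<epsilon>\<^sub>k\<close>, so \<open>x\<close> is an inexact proximal point sequence and
  converges because it is quasi-Fejer monotone with respect to the set of minimizers.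

  For the dual sequence, the residuals tend to \<open>0\<close>, and comparing Lagrangian values with those at the
  dual solution \<open>(\<nabla>h(A x\<^sub>0), c - A\<^sup>T \<nabla>h(A x\<^sub>0))\<close> shows that the Fenchel--Young gap of \<open>h\<close> at
  \<open>(A x\<^sub>0, y\<^sub>k)\<close> tends to \<open>0\<close>. Differentiability of \<open>h\<close> at \<open>A x\<^sub>0\<close> forces \<open>y\<^sub>k\<close> to converge to the gradient.
\<close>

section \<open>Lower semicontinuous functions and existence of proximal points\<close>

lemma lsc_fun_iff_eventually:
  fixes f :: "'a::topological_space \<Rightarrow> ereal"
  shows "lsc_fun f \<longleftrightarrow> (\<forall>x a. a < f x \<longrightarrow> (\<forall>\<^sub>F u in nhds x. a < f u))"
  unfolding lsc_fun_def le_Liminf_iff eventually_nhds_conv_at by blast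

lemma lsc_fun_continuous_add:
  fixes f :: "'a::t2_space \<Rightarrow> ereal" and g :: "'a \<Rightarrow> real"
  assumes "lsc_fun f" and "continuous_on UNIV g"
  shows "lsc_fun (\<lambda>x. ereal (g x) + f x)"
  unfolding lsc_fun_iff_eventually
proof (intro allI impI)
  fix x a assume a: "a < ereal (g x) + f x"
  then have "a - ereal (g x) < f x"
    by (cases a; cases "f x") auto
  \<comment> \<open>A real \<open>d\<close> strictly between splits the bound:
    \<open>g u + d\<close> stays above \<open>a\<close> by continuity, and \<open>f u\<close> stays
    above \<open>d\<close> by lower semicontinuity.\<close>
  then obtain d where d: "a - ereal (g x) < ereal d" "ereal d < f x"
    using ereal_dense2 by blast
  have "isCont g x"
    using assms(2) by (simp add: continuous_on_eq_continuous_at)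
  then have "((\<lambda>u. ereal (g u + d)) \<longlongrightarrow> ereal (g x + d)) (nhds x)"
    unfolding isCont_def tendsto_at_iff_tendsto_nhds by (intro tendsto_intros)
  moreover have "a < ereal (g x + d)"
    using d(1) by (cases a) auto
  ultimately have "\<forall>\<^sub>F u in nhds x. a < ereal (g u + d)"
    by (rule order_tendstoD)
  moreover have "\<forall>\<^sub>F u in nhds x. ereal d < f u"
    using assms(1) d(2) unfolding lsc_fun_iff_eventually by blast
  ultimately show "\<forall>\<^sub>F u in nhds x. a < ereal (g u) + f u"
  proof eventually_elim
    case (elim u)
    then show ?case by (cases a; cases "f u") auto
  qed
qed

lemma lsc_fun_le_limit:
  fixes f :: "'a::topological_space \<Rightarrow> ereal"
  assumes "lsc_fun f" and "w \<longlonglongrightarrow> l" and "\<And>k. f (w k) \<le> ereal (b k)" and "b \<longlonglongrightarrow> B"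
  shows "f l \<le> ereal B"
proof (rule ccontr)
  assume "\<not> f l \<le> ereal B"
  then have "ereal B < f l" by simp
  then obtain a where a: "ereal B < ereal a" "ereal a < f l"
    using ereal_dense2 by blast
  have "\<forall>\<^sub>F k in sequentially. ereal a < f (w k)"
    using eventually_compose_filterlim[OF _ assms(2)] assms(1) a(2)
    unfolding lsc_fun_iff_eventually by blast
  moreover have "\<forall>\<^sub>F k in sequentially. b k < a"
    using assms(4) a(1) by (auto intro: order_tendstoD)
  ultimately have "\<forall>\<^sub>F k in sequentially. False"
  proof eventually_elim
    case (elim k)
    then have "ereal a < ereal (b k)" using assms(3)[of k] by (meson less_le_trans)
    then show ?case using elim by simp
  qed
  then show False by simp
qed

text \<open>Without a minimizer, the open sets \<open>{u. f w < f u}\<close> with \<open>w\<close>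
  in \<open>K\<close> would cover \<open>K\<close>. In a finite subcover the centre with the
  smallest value lies in none of the sets.\<close>

lemma lsc_fun_attains_inf:
  fixes f :: "'a::topological_space \<Rightarrow> ereal"
  assumes "lsc_fun f" and "compact K" and "K \<noteq> {}"
  obtains w where "w \<in> K" and "\<And>u. u \<in> K \<Longrightarrow> f w \<le> f u"
proof (rule ccontr)
  assume "\<not> thesis"
  then have no: "\<forall>w\<in>K. \<exists>w'\<in>K. f w' < f w"
    using that by (meson not_le)
  have op: "open {u. a < f u}" for a
    using assms(1) unfolding lsc_fun_iff_eventually
    by (subst open_subopen) (metis eventually_nhds mem_Collect_eq subsetI)
  have "K \<subseteq> (\<Union>w\<in>K. {u. f w < f u})" using no by blast
  then obtain F where F: "F \<subseteq> K" "finite F" "K \<subseteq> (\<Union>w\<in>F. {u. f w < f u})"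
    using compactE_image[OF assms(2), of K "\<lambda>w. {u. f w < f u}"] op by metis
  then have ne: "F \<noteq> {}" using assms(3) by auto
  define w where "w = arg_min_on f F"
  have "w \<in> F" and "\<not> (\<exists>u\<in>F. f u < f w)"
    unfolding w_def by (rule arg_min_if_finite[OF F(2) ne])+
  then show False using F by blast
qed

text \<open>The lower bound \<open>m\<close> and the quadratic term confine every point that does at
  least as well as \<open>x0\<close> to a ball, so compactness gives a minimizer.\<close>

lemma prox_exists:
  fixes f :: "'a::euclidean_space \<Rightarrow> ereal"
  assumes "lsc_fun f" and lb: "\<And>u. ereal m \<le> f u" and fin: "f x0 = ereal b" and "\<tau> > 0"
  obtains w where "\<And>u. ereal (\<tau> * (norm (u - x))\<^sup>2) + f u \<ge> ereal (\<tau> * (norm (w - x))\<^sup>2) + f w"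
proof -
  define \<phi> where "\<phi> u = ereal (\<tau> * (norm (u - x))\<^sup>2) + f u" for u
  have lsc: "lsc_fun \<phi>"
    unfolding \<phi>_def by (intro lsc_fun_continuous_add assms(1) continuous_intros)
  \<comment> \<open>The radius at which the quadratic term plus \<open>m\<close> reaches the
    objective value at \<open>x0\<close>.\<close>
  define R where "R = sqrt ((\<tau> * (norm (x0 - x))\<^sup>2 + b - m) / \<tau>)"
  have in_ball: "u \<in> cball x R" if "\<phi> u \<le> \<phi> x0" for u
  proof -
    have "ereal (\<tau> * (norm (u - x))\<^sup>2) + ereal m \<le> \<phi> u"
      unfolding \<phi>_def by (intro add_left_mono lb)
    also have "\<dots> \<le> ereal (\<tau> * (norm (x0 - x))\<^sup>2 + b)"
      using that fin by (simp add: \<phi>_def)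
    finally have "(norm (u - x))\<^sup>2 \<le> (\<tau> * (norm (x0 - x))\<^sup>2 + b - m) / \<tau>"
      using \<open>\<tau> > 0\<close> by (simp add: field_simps)
    then show ?thesis
      unfolding R_def by (simp add: dist_norm norm_minus_commute real_le_rsqrt)
  qed
  then have "cball x R \<noteq> {}" by blast
  then obtain w where w: "w \<in> cball x R" "\<And>u. u \<in> cball x R \<Longrightarrow> \<phi> w \<le> \<phi> u"
    using lsc_fun_attains_inf[OF lsc compact_cball] by blast
  have "\<phi> w \<le> \<phi> u" for u
    using w(2)[of u] w(2)[of x0] in_ball[of u] in_ball[of x0] by fastforce
  then show thesis using that unfolding \<phi>_def by blast
qed

section \<open>Gradients, convexity and first-order optimality\<close>

lemma has_derivative_gradient:
  fixes f :: "'a::euclidean_space \<Rightarrow> real"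
  assumes "(f has_derivative f') (at x)"
  obtains d where "(f has_derivative (\<lambda>v. d \<bullet> v)) (at x)"
proof -
  have "linear f'" using assms has_derivative_linear by blast
  then have "f' = (\<lambda>v. adjoint f' 1 \<bullet> v)"
    using adjoint_works[of f' _ 1] by (auto simp: inner_commute)
  then show thesis using that assms by metis
qed

text \<open>Divide by \<open>t\<close> and let \<open>t\<close> decrease to 0. Both the gradient
  inequality for convex functions and the optimality condition for composite objectives reduce to
  this.\<close>

lemma gradient_ge_of_segment_ge:
  fixes g :: "'a::real_inner \<Rightarrow> real"
  assumes "(g has_derivative (\<lambda>v. d \<bullet> v)) (at w)"
    and "\<And>t. 0 < t \<Longrightarrow> t < 1 \<Longrightarrow> t * a \<le> g (w + t *\<^sub>R v) - g w"
  shows "a \<le> d \<bullet> v"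
proof -
  have "((\<lambda>t. g (w + t *\<^sub>R v)) has_derivative (\<lambda>t. d \<bullet> (t *\<^sub>R v))) (at 0)"
    by (rule has_derivative_compose[of "\<lambda>t. w + t *\<^sub>R v" "\<lambda>t. t *\<^sub>R v"])
       (use assms(1) in \<open>auto intro!: derivative_eq_intros\<close>)
  then have "((\<lambda>t. g (w + t *\<^sub>R v)) has_real_derivative (d \<bullet> v)) (at 0)"
    unfolding has_field_derivative_def by (simp add: mult.commute[of _ "d \<bullet> v"])
  then have "((\<lambda>t. (g (w + t *\<^sub>R v) - g w) / t) \<longlongrightarrow> d \<bullet> v) (at_right 0)"
    unfolding DERIV_def by (simp add: filterlim_at_split)
  moreover have "\<forall>\<^sub>F t::real in at_right 0. a \<le> (g (w + t *\<^sub>R v) - g w) / t"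
    unfolding eventually_at_right_field
    by (rule exI[of _ 1]) (use assms(2) in \<open>auto simp: field_simps\<close>)
  ultimately show ?thesis
    by (intro tendsto_lowerbound) auto
qed

lemma convex_on_above_gradient:
  fixes h :: "'a::real_inner \<Rightarrow> real"
  assumes "convex_on UNIV h" and "(h has_derivative (\<lambda>v. d \<bullet> v)) (at w)"
  shows "h w + d \<bullet> (u - w) \<le> h u"
proof -
  \<comment> \<open>Convexity bounds increments of \<open>h\<close> from above, so the segment lemma
    is applied to \<open>- h\<close>.\<close>
  have "((\<lambda>x. - h x) has_derivative (\<lambda>v. (- d) \<bullet> v)) (at w)"
    using has_derivative_minus[OF assms(2)] by simp
  moreover have "t * (h w - h u) \<le> - h (w + t *\<^sub>R (u - w)) - - h w" if "0 < t" "t < 1" for t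
  proof -
    have "h ((1 - t) *\<^sub>R w + t *\<^sub>R u) \<le> (1 - t) * h w + t * h u"
      using that by (intro convex_onD[OF assms(1)]) auto
    moreover have "(1 - t) *\<^sub>R w + t *\<^sub>R u = w + t *\<^sub>R (u - w)"
      by (simp add: algebra_simps)
    ultimately show ?thesis by (simp add: algebra_simps)
  qed
  ultimately have "h w - h u \<le> (- d) \<bullet> (u - w)"
    by (rule gradient_ge_of_segment_ge)
  then show ?thesis by simp
qed

text \<open>Fermat's rule: \<open>- d\<close> is a subgradient of \<open>p\<close> at the minimizer
  \<open>w\<close> of \<open>g + p\<close>. Compare \<open>w\<close> with points of the segment
  towards \<open>u\<close>, where convexity bounds \<open>p\<close>.\<close>

lemma composite_minimizer_subgradient:
  fixes g :: "'a::real_inner \<Rightarrow> real" and p :: "'a \<Rightarrow> ereal"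
  assumes "convex_ereal p" and "\<And>u. p u \<noteq> -\<infinity>" and pw: "p w = ereal b"
    and d: "(g has_derivative (\<lambda>v. d \<bullet> v)) (at w)"
    and min: "\<And>u. ereal (g w) + p w \<le> ereal (g u) + p u"
  shows "ereal (b - d \<bullet> (u - w)) \<le> p u"
proof (cases "p u")
  case (real a)
  have "t * (b - a) \<le> g (w + t *\<^sub>R (u - w)) - g w" if "0 < t" "t < 1" for t
  proof -
    have eq: "(1 - t) *\<^sub>R w + t *\<^sub>R u = w + t *\<^sub>R (u - w)"
      by (simp add: algebra_simps)
    have "p ((1 - t) *\<^sub>R w + t *\<^sub>R u) \<le> ereal (1 - t) * p w + ereal t * p u"
      using assms(1) that unfolding convex_ereal_def by auto
    then have "p (w + t *\<^sub>R (u - w)) \<le> ereal ((1 - t) * b + t * a)"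
      using real pw eq by simp
    then have "ereal (g w + b) \<le> ereal (g (w + t *\<^sub>R (u - w)) + ((1 - t) * b + t * a))"
      using min[of "w + t *\<^sub>R (u - w)"] pw
      by (cases "p (w + t *\<^sub>R (u - w))") auto
    then show ?thesis by (simp add: algebra_simps)
  qed
  from gradient_ge_of_segment_ge[OF d this] show ?thesis
    using real by simp
qed (use assms(2) in auto)

section \<open>Fenchel conjugates\<close>

lemma fenchel_young:
  assumes "f u = ereal b"
  shows "ereal (y \<bullet> u - b) \<le> fenchel_conjugate f y"
  unfolding fenchel_conjugate_def
  by (rule SUP_upper2[of u]) (use assms in auto)

text \<open>The equality case of the Fenchel--Young inequality: a subgradient at \<open>u\<close>
  makes the supremum attained at \<open>u\<close>.\<close>

lemma fenchel_conjugate_at_subgradient: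
  assumes "f u = ereal b" and "\<And>v. ereal (b + y \<bullet> (v - u)) \<le> f v"
  shows "fenchel_conjugate f y = ereal (y \<bullet> u - b)"
proof (rule antisym)
  have "ereal (y \<bullet> v) - f v \<le> ereal (y \<bullet> u - b)" for v
    using assms(2)[of v] by (cases "f v") (auto simp: inner_diff_right)
  then show "fenchel_conjugate f y \<le> ereal (y \<bullet> u - b)"
    unfolding fenchel_conjugate_def by (intro SUP_least)
qed (rule fenchel_young[where f = f, OF assms(1)])

text \<open>Near \<open>u\<close>, differentiability keeps \<open>h\<close> below its linearization
  plus a small multiple of the distance. If \<open>y k\<close> differed much from \<open>d\<close>,
  a test point in the direction \<open>y k - d\<close> would make the conjugate exceed the bound in
  \<open>gap\<close>.\<close>

lemma fenchel_conjugate_gap_tendsto: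
  fixes h :: "'a::real_inner \<Rightarrow> real"
  assumes d: "(h has_derivative (\<lambda>v. d \<bullet> v)) (at u)"
    and gap: "\<And>k. fenchel_conjugate (\<lambda>v. ereal (h v)) (y k) \<le> ereal (y k \<bullet> u - h u + G k)"
    and G: "G \<longlonglongrightarrow> 0"
  shows "y \<longlonglongrightarrow> d"
proof (rule LIMSEQ_I)
  fix r :: real assume r: "0 < r"
  obtain \<delta> where \<delta>: "\<delta> > 0"
    "\<And>v. norm (v - u) < \<delta> \<Longrightarrow> norm (h v - h u - d \<bullet> (v - u)) \<le> r / 2 * norm (v - u)"
    using d r unfolding has_derivative_at_alt by (meson half_gt_zero)
  have "\<forall>\<^sub>F k in sequentially. G k < \<delta> / 2 * (r / 2)"
    using G r \<delta>(1) by (intro order_tendstoD) auto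
  then obtain N where N: "\<And>k. k \<ge> N \<Longrightarrow> G k < \<delta> / 2 * (r / 2)"
    unfolding eventually_sequentially by blast
  have "norm (y k - d) < r" if "k \<ge> N" for k
  proof (cases "y k = d")
    case False
    \<comment> \<open>The test point sits at distance \<open>\<delta> / 2\<close> from
      \<open>u\<close>, inside the region where the linearization error is controlled. That error
      and \<open>G k\<close> each use up half of \<open>\<delta> / 2 * r\<close>.\<close>
    define v where "v = u + (\<delta> / 2 / norm (y k - d)) *\<^sub>R (y k - d)"
    have nv: "norm (v - u) = \<delta> / 2" using False \<delta>(1) by (simp add: v_def)
    have "norm (h v - h u - d \<bullet> (v - u)) \<le> r / 2 * (\<delta> / 2)"
      using \<delta>(2)[of v] \<delta>(1) unfolding nv by simp
    then have "h v - h u - d \<bullet> (v - u) \<le> \<delta> / 2 * (r / 2)"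
      unfolding real_norm_def mult.commute[of "\<delta> / 2"] by linarith
    moreover have "y k \<bullet> v - h v \<le> y k \<bullet> u - h u + G k"
      using order_trans[OF fenchel_young[of "\<lambda>v. ereal (h v)" v "h v" "y k"] gap[of k]] by simp
    moreover have "(y k - d) \<bullet> (v - u) = \<delta> / 2 * norm (y k - d)"
      using False by (simp add: v_def dot_square_norm power2_eq_square)
    ultimately have "\<delta> / 2 * norm (y k - d) \<le> G k + \<delta> / 2 * (r / 2)"
      by (simp only: inner_diff_left inner_diff_right)
    also have "\<dots> < \<delta> / 2 * r" using N[OF that] by simp
    finally show ?thesis using \<delta>(1) by simp
  qed (use r in auto)
  then show "\<exists>N. \<forall>k\<ge>N. norm (y k - d) < r" by blast
qed

section \<open>Inexact proximal point sequences\<close>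

text \<open>Subtracting the partial sums of the errors leaves a decreasing sequence that is bounded
  below.\<close>

lemma convergent_of_quasi_decreasing:
  fixes a \<epsilon> :: "nat \<Rightarrow> real"
  assumes "\<And>k. 0 \<le> a k" and "\<And>k. a (Suc k) \<le> a k + \<epsilon> k" and "\<And>k. 0 \<le> \<epsilon> k" and "summable \<epsilon>"
  shows "convergent a"
proof -
  define b where "b k = a k - (\<Sum>i<k. \<epsilon> i)" for k
  have "decseq b"
    using assms(2) by (intro decseq_SucI) (simp add: b_def algebra_simps)
  moreover have "- suminf \<epsilon> \<le> b k" for k
    using assms(1)[of k] sum_le_suminf[OF assms(4), of "{..<k}"] assms(3) by (simp add: b_def)
  ultimately have "convergent b"
    using decseq_convergent convergentI by metis
  moreover have "convergent (\<lambda>k. \<Sum>i<k. \<epsilon> i)"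
    using assms(4) by (simp add: summable_iff_convergent)
  ultimately have "convergent (\<lambda>k. b k + (\<Sum>i<k. \<epsilon> i))" by (rule convergent_add)
  then show ?thesis by (simp add: b_def)
qed

text \<open>By \<open>sub\<close>, \<open>(x k - w k) / \<sigma> k\<close> is a subgradient of
  \<open>f\<close> at \<open>w k\<close>, which encodes that \<open>w k\<close> is an exact proximal
  point. Distances from \<open>x k\<close> to each minimizer converge; once a cluster point is known
  to be a minimizer, its own distance must tend to 0.\<close>

lemma inexact_proximal_point_convergence:
  fixes f :: "'a::euclidean_space \<Rightarrow> ereal" and x w :: "nat \<Rightarrow> 'a"
  assumes lsc: "lsc_fun f" and min: "\<And>u. f x0 \<le> f u" and fin: "f x0 = ereal m"
    and \<epsilon>: "\<And>k. 0 \<le> \<epsilon> k" "summable \<epsilon>" and \<sigma>: "0 < s" "\<And>k. s \<le> \<sigma> k"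
    and close: "\<And>k. norm (x (Suc k) - w k) \<le> \<epsilon> k"
    and fw: "\<And>k. f (w k) = ereal (b k)"
    and sub: "\<And>k u. ereal (b k + ((x k - w k) \<bullet> (u - w k)) / \<sigma> k) \<le> f u"
  obtains l where "\<And>u. f l \<le> f u" and "f l = ereal m" and "x \<longlonglongrightarrow> l"
proof -
  \<comment> \<open>Expand the square of \<open>x k - v\<close> around \<open>w k\<close>; the
    subgradient inequality at \<open>v\<close> controls the cross term.\<close>
  have key: "2 * \<sigma> k * (b k - m) + (norm (x k - w k))\<^sup>2 + (norm (w k - v))\<^sup>2 \<le> (norm (x k - v))\<^sup>2"
    if "f v = ereal m" for k v
  proof -
    have \<sigma>k: "0 < \<sigma> k" using \<sigma>(1) \<sigma>(2)[of k] by linarith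
    have "b k + ((x k - w k) \<bullet> (v - w k)) / \<sigma> k \<le> m"
      using sub[of k v] that by simp
    then have "\<sigma> k * (b k - m) \<le> - ((x k - w k) \<bullet> (v - w k))"
      using \<sigma>k by (simp add: field_simps)
    moreover have "(norm (x k - v))\<^sup>2 = (norm ((x k - w k) - (v - w k)))\<^sup>2" by simp
    moreover have "(norm ((x k - w k) - (v - w k)))\<^sup>2
        = (norm (x k - w k))\<^sup>2 + (norm (v - w k))\<^sup>2 - 2 * ((x k - w k) \<bullet> (v - w k))"
      using dot_norm_neg[of "x k - w k" "v - w k"] by simp
    moreover have "norm (w k - v) = norm (v - w k)" by (rule norm_minus_commute)
    ultimately show ?thesis by (simp add: algebra_simps)
  qed
  have bm: "m \<le> b k" for k using min[of "w k"] fin fw[of k] by simp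
  have gap: "0 \<le> 2 * \<sigma> k * (b k - m)" for k
    using bm[of k] \<sigma>(1) \<sigma>(2)[of k] by simp
  have fejer: "norm (w k - v) \<le> norm (x k - v)" if "f v = ereal m" for k v
  proof (rule power2_le_imp_le)
    show "(norm (w k - v))\<^sup>2 \<le> (norm (x k - v))\<^sup>2"
      using key[OF that, of k] gap[of k] zero_le_power2[of "norm (x k - w k)"] by linarith
  qed simp
  have step: "norm (x (Suc k) - v) \<le> norm (w k - v) + \<epsilon> k" for k v
    using norm_triangle_ineq[of "x (Suc k) - w k" "w k - v"] close[of k] by simp
  have conv: "convergent (\<lambda>k. norm (x k - v))" if "f v = ereal m" for v
  proof (rule convergent_of_quasi_decreasing[OF _ _ \<epsilon>])
    show "norm (x (Suc k) - v) \<le> norm (x k - v) + \<epsilon> k" for k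
      using step[of k v] fejer[OF that, of k] by linarith
  qed simp
  obtain L where L: "(\<lambda>k. norm (x k - x0)) \<longlonglongrightarrow> L" using conv[OF fin] convergentD by blast
  have \<epsilon>0: "\<epsilon> \<longlonglongrightarrow> 0" using \<epsilon>(2) by (rule summable_LIMSEQ_zero)
  \<comment> \<open>The distance from \<open>w k\<close> to \<open>x0\<close> is squeezed between
    those of \<open>x (Suc k)\<close>, up to \<open>\<epsilon> k\<close>, and
    \<open>x k\<close>.\<close>
  have wL: "(\<lambda>k. norm (w k - x0)) \<longlonglongrightarrow> L"
  proof (rule tendsto_sandwich)
    show "\<forall>\<^sub>F k in sequentially. norm (x (Suc k) - x0) - \<epsilon> k \<le> norm (w k - x0)"
      using step[of _ x0] by (auto simp: algebra_simps)
    show "\<forall>\<^sub>F k in sequentially. norm (w k - x0) \<le> norm (x k - x0)"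
      using fejer[OF fin] by simp
    show "(\<lambda>k. norm (x (Suc k) - x0) - \<epsilon> k) \<longlonglongrightarrow> L"
      using tendsto_diff[OF LIMSEQ_Suc[OF L] \<epsilon>0] by simp
  qed (rule L)
  \<comment> \<open>By \<open>key\<close>, this vanishing quantity dominates both the squared
    proximal step and \<open>2 * \<sigma> k\<close> times the objective gap at
    \<open>w k\<close>.\<close>
  define D where "D k = (norm (x k - x0))\<^sup>2 - (norm (w k - x0))\<^sup>2" for k
  have D0: "D \<longlonglongrightarrow> 0"
    unfolding D_def using tendsto_diff[OF tendsto_power[OF L, of 2] tendsto_power[OF wL, of 2]] by simp
  have xw: "(\<lambda>k. x k - w k) \<longlonglongrightarrow> 0"
  proof -
    have "(\<lambda>k. (norm (x k - w k))\<^sup>2) \<longlonglongrightarrow> 0"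
    proof (rule tendsto_sandwich[OF _ _ tendsto_const D0])
      show "\<forall>\<^sub>F k in sequentially. (norm (x k - w k))\<^sup>2 \<le> D k"
      proof (intro always_eventually allI)
        show "(norm (x k - w k))\<^sup>2 \<le> D k" for k
          using key[OF fin, of k] gap[of k] unfolding D_def by linarith
      qed
    qed simp
    then have "(\<lambda>k. sqrt ((norm (x k - w k))\<^sup>2)) \<longlonglongrightarrow> sqrt 0" by (rule tendsto_real_sqrt)
    then show ?thesis by (simp add: tendsto_norm_zero_iff)
  qed
  define B where "B k = m + D k / (2 * s)" for k
  have B: "B \<longlonglongrightarrow> m"
    using tendsto_add[OF tendsto_const[of m] tendsto_divide_zero[OF D0, of "2 * s"]]
    unfolding B_def by simp
  have fB: "f (w k) \<le> ereal (B k)" for k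
  proof -
    have "2 * s * (b k - m) \<le> 2 * \<sigma> k * (b k - m)"
      using \<sigma>(2)[of k] bm[of k] by (intro mult_right_mono) auto
    also have "\<dots> \<le> D k"
      using key[OF fin, of k] zero_le_power2[of "norm (x k - w k)"] unfolding D_def by linarith
    finally show ?thesis using \<sigma>(1) fw[of k] by (simp add: B_def field_simps)
  qed
  have "Bseq (\<lambda>k. norm (x k - x0))" 
    using conv[OF fin] by (rule convergent_imp_Bseq)
  then have "bounded (range (\<lambda>k. x k - x0))" by (simp add: Bseq_eq_bounded bounded_iff)
  then have "bounded (range (\<lambda>k. x0 + (x k - x0)))"
    using bounded_translation[of "range (\<lambda>k. x k - x0)" x0] by (simp add: image_image)
  then have "bounded (range x)" by simp
  then obtain l \<rho> where \<rho>: "strict_mono \<rho>" "(x \<circ> \<rho>) \<longlonglongrightarrow> l"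
    using bounded_imp_convergent_subsequence by metis
  \<comment> \<open>Pass to \<open>w\<close>, which has the same limit along \<open>\<rho>\<close>:
    the objective values are controlled at \<open>w k\<close>, whereas \<open>f (x k)\<close> may be
    infinite.\<close>
  have "(\<lambda>k. (x \<circ> \<rho>) k - (x (\<rho> k) - w (\<rho> k))) \<longlonglongrightarrow> l - 0"
    using LIMSEQ_subseq_LIMSEQ[OF xw \<rho>(1)] by (intro tendsto_diff \<rho>(2)) (simp add: o_def)
  then have "(\<lambda>k. w (\<rho> k)) \<longlonglongrightarrow> l" by simp
  moreover have "(\<lambda>k. B (\<rho> k)) \<longlonglongrightarrow> m" using LIMSEQ_subseq_LIMSEQ[OF B \<rho>(1)] by (simp add: o_def)
  ultimately have "f l \<le> ereal m" using lsc_fun_le_limit[OF lsc _ fB] by blast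
  then have fl: "f l = ereal m" using min[of l] fin by simp
  obtain L' where L': "(\<lambda>k. norm (x k - l)) \<longlonglongrightarrow> L'" using conv[OF fl] convergentD by blast
  have "(\<lambda>k. norm ((x \<circ> \<rho>) k - l)) \<longlonglongrightarrow> 0"
    using \<rho>(2) by (intro tendsto_norm_zero LIM_zero)
  moreover have "(\<lambda>k. norm ((x \<circ> \<rho>) k - l)) \<longlonglongrightarrow> L'"
    using LIMSEQ_subseq_LIMSEQ[OF L' \<rho>(1)] by (simp add: o_def)
  ultimately have "L' = 0" using LIMSEQ_unique by blast
  then have "x \<longlonglongrightarrow> l" using L' by (simp add: LIM_zero_cancel tendsto_norm_zero_iff)
  then show thesis using that fl min fin by simp
qed


section \<open>The augmented Lagrangian and the proximal step\<close>

lemma has_derivative_matrix_affine: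
  fixes A :: "real^'n^'m" and h :: "real^'m \<Rightarrow> real"
  assumes "(h has_derivative (\<lambda>v. d \<bullet> v)) (at (A *v w))"
  shows "((\<lambda>u. h (A *v u) - c \<bullet> u) has_derivative (\<lambda>v. (transpose A *v d - c) \<bullet> v)) (at w)"
proof -
  have "((\<lambda>u. A *v u) has_derivative (\<lambda>v. A *v v)) (at w)"
    by (intro bounded_linear_imp_has_derivative) simp
  then have "((\<lambda>u. h (A *v u)) has_derivative (\<lambda>v. d \<bullet> (A *v v))) (at w)"
    using assms by (rule has_derivative_compose)
  moreover have "((\<lambda>u. c \<bullet> u) has_derivative (\<lambda>v. c \<bullet> v)) (at w)"
    by (intro bounded_linear_imp_has_derivative bounded_linear_inner_right)
  ultimately have "((\<lambda>u. h (A *v u) - c \<bullet> u) has_derivative (\<lambda>v. d \<bullet> (A *v v) - c \<bullet> v)) (at w)"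
    by (rule has_derivative_diff)
  then show ?thesis by (simp add: inner_diff_left dot_lmul_matrix)
qed

lemma fenchel_conjugate_gradient:
  assumes "convex_on UNIV h" and "(h has_derivative (\<lambda>v. d \<bullet> v)) (at u)"
  shows "fenchel_conjugate (\<lambda>v. ereal (h v)) d = ereal (d \<bullet> u - h u)"
  using convex_on_above_gradient[OF assms]
  by (intro fenchel_conjugate_at_subgradient) auto

text \<open>The conjugates may be infinite; real lower bounds for them keep later estimates in real
  arithmetic.\<close>

lemma augmented_Lagrangian_ge:
  assumes "ereal \<alpha> \<le> fenchel_conjugate (\<lambda>u. ereal (h u)) y" and "ereal \<beta> \<le> fenchel_conjugate p z"
  shows "ereal (\<alpha> + \<beta> - x \<bullet> (transpose A *v y + z - c)
             + \<sigma> / 2 * (norm (transpose A *v y + z - c))\<^sup>2)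
         \<le> augmented_Lagrangian h A c p \<sigma> y z x"
  using assms unfolding augmented_Lagrangian_def
  by (cases "fenchel_conjugate (\<lambda>u. ereal (h u)) y"; cases "fenchel_conjugate p z") auto

text \<open>Fenchel--Young at \<open>w\<close>, then completing the square; when \<open>w\<close> is the proximal point of \<open>x\<close>, the last
  two terms are the negative Moreau envelope.\<close>

lemma augmented_Lagrangian_ge_prox:
  fixes A :: "real^'n^'m"
  assumes "p w = ereal b" and "\<sigma> > 0"
  shows "ereal ((norm (x - \<sigma> *\<^sub>R (transpose A *v y + z - c) - w))\<^sup>2 / (2 * \<sigma>)
             - (h (A *v w) - c \<bullet> w + b) - (norm (x - w))\<^sup>2 / (2 * \<sigma>))
         \<le> augmented_Lagrangian h A c p \<sigma> y z x"
proof -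
  define r where "r = transpose A *v y + z - c"
  have "y \<bullet> (A *v w) + z \<bullet> w = (r + c) \<bullet> w"
    by (simp add: r_def inner_add_left dot_lmul_matrix)
  moreover have "(norm ((x - w) - \<sigma> *\<^sub>R r))\<^sup>2
      = (norm (x - w))\<^sup>2 + \<sigma>\<^sup>2 * (norm r)\<^sup>2 - 2 * (\<sigma> * ((x - w) \<bullet> r))"
    using dot_norm_neg[of "x - w" "\<sigma> *\<^sub>R r"] by (simp add: power_mult_distrib)
  then have "(norm (x - \<sigma> *\<^sub>R r - w))\<^sup>2 / (2 * \<sigma>) - (norm (x - w))\<^sup>2 / (2 * \<sigma>)
      = \<sigma> / 2 * (norm r)\<^sup>2 - (x - w) \<bullet> r"
    using \<open>\<sigma> > 0\<close> by (simp add: field_simps power2_eq_square)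
  ultimately have "(norm (x - \<sigma> *\<^sub>R r - w))\<^sup>2 / (2 * \<sigma>)
        - (h (A *v w) - c \<bullet> w + b) - (norm (x - w))\<^sup>2 / (2 * \<sigma>)
      = (y \<bullet> (A *v w) - h (A *v w)) + (z \<bullet> w - b) - x \<bullet> r + \<sigma> / 2 * (norm r)\<^sup>2"
    by (simp add: inner_add_left inner_diff_left inner_commute[of r])
  note eq = this[unfolded r_def]
  show ?thesis
    unfolding eq
    using augmented_Lagrangian_ge[of "y \<bullet> (A *v w) - h (A *v w)" h y "z \<bullet> w - b" p z x A c \<sigma>]
      fenchel_young[of "\<lambda>u. ereal (h u)" "A *v w" "h (A *v w)" y]
      fenchel_young[of p w b z, OF assms(1)]
    by blast
qed

text \<open>A primal solution bounds the objective below, so a proximal point \<open>w\<close> of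
  \<open>x\<close> exists. Fermat's rule there yields the subgradient of \<open>p\<close> that later
  serves as the dual variable \<open>z\<close>.\<close>

lemma prox_subgradient_exists:
  fixes A :: "real^'n^'m" and dh :: "real^'m \<Rightarrow> real^'m"
  assumes dh: "\<And>u. (h has_derivative (\<lambda>v. dh u \<bullet> v)) (at u)"
    and p: "proper_fun p" "lsc_fun p" "convex_ereal p"
    and opt: "primal_optimal h A c p x0" and "\<sigma> > 0"
  obtains w b where "p w = ereal b"
    and "\<And>u. ereal (b + (c - transpose A *v dh (A *v w) + (1 / \<sigma>) *\<^sub>R (x - w)) \<bullet> (u - w)) \<le> p u"
proof -
  define \<phi> where "\<phi> u = h (A *v u) - c \<bullet> u" for u
  define \<tau> where "\<tau> = 1 / (2 * \<sigma>)"
  have d\<phi>: "(\<phi> has_derivative (\<lambda>v. (transpose A *v dh (A *v w) - c) \<bullet> v)) (at w)" for w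
    unfolding \<phi>_def by (rule has_derivative_matrix_affine[OF dh])
  then have "continuous_on UNIV \<phi>"
    by (meson continuous_at_imp_continuous_on has_derivative_continuous)
  then have lsc: "lsc_fun (\<lambda>u. ereal (\<phi> u) + p u)"
    by (rule lsc_fun_continuous_add[OF p(2)])
  have pninf: "p u \<noteq> -\<infinity>" for u using p(1) unfolding proper_fun_def by blast
  have x0min: "ereal (\<phi> x0) + p x0 \<le> ereal (\<phi> u) + p u" for u
    using opt unfolding primal_optimal_def optimal_solution_def is_arg_min_def primal_objective_def \<phi>_def
    by (metis not_le)
  obtain b0 where b0: "p x0 = ereal b0"
    using opt pninf[of x0] unfolding primal_optimal_def optimal_solution_def primal_objective_def
    by (cases "p x0") auto
  have "\<tau> > 0" using \<open>\<sigma> > 0\<close> by (simp add: \<tau>_def)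
  then obtain w where w: "\<And>u. ereal (\<tau> * (norm (w - x))\<^sup>2) + (ereal (\<phi> w) + p w)
      \<le> ereal (\<tau> * (norm (u - x))\<^sup>2) + (ereal (\<phi> u) + p u)"
    using prox_exists[OF lsc, of "\<phi> x0 + b0" x0 "\<phi> x0 + b0" \<tau> x] x0min b0 by auto
  \<comment> \<open>The quadratic joins the smooth part, leaving \<open>p\<close> as the only
    nonsmooth summand.\<close>
  define g where "g u = \<tau> * (norm (u - x))\<^sup>2 + \<phi> u" for u
  have gmin: "ereal (g w) + p w \<le> ereal (g u) + p u" for u
    using w[of u] unfolding g_def by (simp add: add.assoc[symmetric])
  obtain b where b: "p w = ereal b"
    using gmin[of x0] b0 pninf[of w] by (cases "p w") auto
  define d where "d = (2 * \<tau>) *\<^sub>R (w - x) + (transpose A *v dh (A *v w) - c)"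
  have "((\<lambda>u. \<tau> * (norm (u - x))\<^sup>2) has_derivative (\<lambda>v. ((2 * \<tau>) *\<^sub>R (w - x)) \<bullet> v)) (at w)"
    unfolding power2_norm_eq_inner
    by (auto intro!: derivative_eq_intros simp: inner_commute)
  then have "(g has_derivative (\<lambda>v. d \<bullet> v)) (at w)"
    unfolding g_def d_def inner_add_left by (intro has_derivative_add d\<phi>)
  then have "ereal (b - d \<bullet> (u - w)) \<le> p u" for u
    using composite_minimizer_subgradient[OF p(3) pninf b _ gmin] by blast
  moreover have "- d = c - transpose A *v dh (A *v w) + (1 / \<sigma>) *\<^sub>R (x - w)"
    unfolding d_def \<tau>_def using \<open>\<sigma> > 0\<close> by (simp add: algebra_simps)
  then have "b - d \<bullet> v = b + (c - transpose A *v dh (A *v w) + (1 / \<sigma>) *\<^sub>R (x - w)) \<bullet> v" for v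
    by (metis diff_conv_add_uminus inner_minus_left)
  ultimately show thesis using that b by simp
qed

text \<open>The lower bound drops the square in \<open>augmented_Lagrangian_ge_prox\<close>. It is
  attained at the gradient of \<open>h\<close> at \<open>A *v w\<close> paired with the subgradient
  in \<open>sub\<close>, where both Fenchel--Young inequalities are equalities.\<close>

lemma INF_augmented_Lagrangian:
  fixes A :: "real^'n^'m" and dh :: "real^'m \<Rightarrow> real^'m"
  assumes "convex_on UNIV h" and dh: "\<And>u. (h has_derivative (\<lambda>v. dh u \<bullet> v)) (at u)"
    and "\<sigma> > 0" and pw: "p w = ereal b"
    and sub: "\<And>u. ereal (b + (c - transpose A *v dh (A *v w) + (1 / \<sigma>) *\<^sub>R (x - w)) \<bullet> (u - w)) \<le> p u"
  shows "(INF (v, w). augmented_Lagrangian h A c p \<sigma> v w x)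
       = ereal (- (h (A *v w) - c \<bullet> w + b) - (norm (x - w))\<^sup>2 / (2 * \<sigma>))" (is "_ = ereal ?V")
proof (rule antisym)
  show "ereal ?V \<le> (INF (v, w). augmented_Lagrangian h A c p \<sigma> v w x)"
  proof (rule INF_greatest)
    fix yz :: "(real^'m) \<times> (real^'n)"
    obtain y z where yz: "yz = (y, z)" by fastforce
    have "ereal ?V \<le> ereal ((norm (x - \<sigma> *\<^sub>R (transpose A *v y + z - c) - w))\<^sup>2 / (2 * \<sigma>)
             - (h (A *v w) - c \<bullet> w + b) - (norm (x - w))\<^sup>2 / (2 * \<sigma>))"
      using \<open>\<sigma> > 0\<close> by simp
    also have "\<dots> \<le> augmented_Lagrangian h A c p \<sigma> y z x"
      by (rule augmented_Lagrangian_ge_prox[of p, OF pw \<open>\<sigma> > 0\<close>])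
    finally show "ereal ?V \<le> (case yz of (v, w) \<Rightarrow> augmented_Lagrangian h A c p \<sigma> v w x)"
      by (simp add: yz)
  qed
  define y where "y = dh (A *v w)"
  define r where "r = (1 / \<sigma>) *\<^sub>R (x - w)"
  \<comment> \<open>The residual of \<open>(y, z)\<close> is then \<open>r\<close>, so the
    multiplier update \<open>x - \<sigma> *\<^sub>R r\<close> lands exactly on \<open>w\<close> and
    the dropped square is zero.\<close>
  define z where "z = c - transpose A *v y + r"
  have hy: "fenchel_conjugate (\<lambda>v. ereal (h v)) y = ereal (y \<bullet> (A *v w) - h (A *v w))"
    unfolding y_def by (rule fenchel_conjugate_gradient[OF assms(1) dh])
  have pz: "fenchel_conjugate p z = ereal (z \<bullet> w - b)"
    using sub unfolding z_def y_def r_def by (intro fenchel_conjugate_at_subgradient[of p, OF pw])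
  have r: "transpose A *v y + z - c = r" by (simp add: z_def)
  have "y \<bullet> (A *v w) + z \<bullet> w = c \<bullet> w + r \<bullet> w"
    by (simp add: z_def inner_add_left inner_diff_left dot_lmul_matrix)
  moreover have "r \<bullet> w - x \<bullet> r + \<sigma> / 2 * (norm r)\<^sup>2 = - (norm (x - w))\<^sup>2 / (2 * \<sigma>)"
  proof -
    have "r \<bullet> w - x \<bullet> r = - ((x - w) \<bullet> r)" by (simp add: inner_diff_left inner_commute[of r])
    also have "\<dots> = - (norm (x - w))\<^sup>2 / \<sigma>" by (simp add: r_def dot_square_norm)
    finally have 1: "r \<bullet> w - x \<bullet> r = - (norm (x - w))\<^sup>2 / \<sigma>" .
    have "norm r = norm (x - w) / \<sigma>" using \<open>\<sigma> > 0\<close> by (simp add: r_def)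
    then have "\<sigma> / 2 * (norm r)\<^sup>2 = (norm (x - w))\<^sup>2 / (2 * \<sigma>)"
      using \<open>\<sigma> > 0\<close> by (simp add: power2_eq_square)
    then show ?thesis using 1 by (simp add: field_simps)
  qed
  ultimately have "augmented_Lagrangian h A c p \<sigma> y z x = ereal ?V"
    unfolding augmented_Lagrangian_def hy pz r by simp
  then show "(INF (v, w). augmented_Lagrangian h A c p \<sigma> v w x) \<le> ereal ?V"
    by (intro INF_lower2[of "(y, z)"]) auto
qed

theorem theorem16:
  fixes A :: "real^'n^'m" and c :: "real^'n"
    and h :: "real^'m \<Rightarrow> real" and p :: "real^'n \<Rightarrow> ereal"
    and \<sigma> \<epsilon> :: "nat \<Rightarrow> real" and \<sigma>_inf :: ereal
    and y :: "nat \<Rightarrow> real^'m" and z x :: "nat \<Rightarrow> real^'n"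
  assumes "convex_on UNIV h" and "strongly_convex h" and "C2_smooth h"
    and "proper_fun p" and "lsc_fun p" and "convex_ereal p"
    and "\<exists>x\<^sub>0. primal_optimal h A c p x\<^sub>0"
    and "CNAL_sequence h A c p \<sigma> \<sigma>_inf \<epsilon> y z x"
  shows "(\<exists>x_opt. primal_optimal h A c p x_opt \<and> x \<longlonglongrightarrow> x_opt) \<and>
         (\<exists>y_opt z_opt. dual_optimal h A c p (y_opt, z_opt) \<and>
            (\<lambda>k. (y k, z k)) \<longlonglongrightarrow> (y_opt, z_opt))"
proof -
  have "\<forall>u. \<exists>d. (h has_derivative (\<lambda>v. d \<bullet> v)) (at u)"
    using assms(3) has_derivative_gradient unfolding C2_smooth_def by metis
  then obtain dh where dh: "\<And>u. (h has_derivative (\<lambda>v. dh u \<bullet> v)) (at u)" by metis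
  obtain x0 where x0: "primal_optimal h A c p x0" using assms(7) by blast
  let ?f = "primal_objective h A c p"
  let ?AL = "augmented_Lagrangian h A c p"
  define r where "r k = transpose A *v y (Suc k) + z (Suc k) - c" for k
  have \<epsilon>: "\<And>k. 0 \<le> \<epsilon> k" "summable \<epsilon>"
    and stop: "\<And>k. ?AL (\<sigma> k) (y (Suc k)) (z (Suc k)) (x k) - (INF (v, w). ?AL (\<sigma> k) v w (x k))
          \<le> ereal ((\<epsilon> k)\<^sup>2 / (2 * \<sigma> k))"
    and update: "\<And>k. x (Suc k) = x k - \<sigma> k *\<^sub>R r k"
    and \<sigma>0: "0 < \<sigma> 0" and \<sigma>mono: "\<And>k. \<sigma> k \<le> \<sigma> (Suc k)"
    using assms(8) unfolding CNAL_sequence_def r_def by auto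
  have \<sigma>ge: "\<sigma> 0 \<le> \<sigma> k" for k using \<sigma>mono by (rule lift_Suc_mono_le) simp
  have \<sigma>pos: "0 < \<sigma> k" for k using \<sigma>0 \<sigma>ge[of k] by linarith

  \<comment> \<open>Proximal points and convergence of the primal sequence\<close>
  have pninf: "p u \<noteq> -\<infinity>" for u using assms(4) unfolding proper_fun_def by blast
  have fmin: "?f x0 \<le> ?f u" for u
    using x0 unfolding primal_optimal_def optimal_solution_def is_arg_min_def by (meson not_le)
  obtain p0 where p0: "p x0 = ereal p0"
    using x0 pninf[of x0] unfolding primal_optimal_def optimal_solution_def primal_objective_def
    by (cases "p x0") auto
  have dphi: "((\<lambda>u. h (A *v u) - c \<bullet> u) has_derivative (\<lambda>v. (transpose A *v dh (A *v w) - c) \<bullet> v)) (at w)" for w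
    by (rule has_derivative_matrix_affine[OF dh])
  then have "continuous_on UNIV (\<lambda>u. h (A *v u) - c \<bullet> u)"
    by (meson continuous_at_imp_continuous_on has_derivative_continuous)
  then have lsc: "lsc_fun ?f"
    using lsc_fun_continuous_add[OF assms(5)] unfolding primal_objective_def by blast

  have "\<exists>w b. p w = ereal b \<and>
      (\<forall>u. ereal (b + (c - transpose A *v dh (A *v w) + (1 / \<sigma> k) *\<^sub>R (x k - w)) \<bullet> (u - w)) \<le> p u)" for k
    using prox_subgradient_exists[OF dh assms(4-6) x0 \<sigma>pos[of k], of "x k"] by metis
  then obtain w b where pw: "\<And>k. p (w k) = ereal (b k)"
    and sub: "\<And>k u. ereal (b k + (c - transpose A *v dh (A *v w k) + (1 / \<sigma> k) *\<^sub>R (x k - w k)) \<bullet> (u - w k)) \<le> p u"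
    by metis
  define F where "F k = h (A *v w k) - c \<bullet> w k + b k" for k
  have inf: "(INF (v, w). ?AL (\<sigma> k) v w (x k)) = ereal (- F k - (norm (x k - w k))\<^sup>2 / (2 * \<sigma> k))" for k
    unfolding F_def by (rule INF_augmented_Lagrangian[OF assms(1) dh \<sigma>pos pw sub])
  \<comment> \<open>The infimum is finite, so it can be moved across the extended-real
    inequality.\<close>
  have stop': "?AL (\<sigma> k) (y (Suc k)) (z (Suc k)) (x k)
      \<le> ereal (- F k - (norm (x k - w k))\<^sup>2 / (2 * \<sigma> k) + (\<epsilon> k)\<^sup>2 / (2 * \<sigma> k))" for k
    using stop[of k] unfolding inf
    by (cases "?AL (\<sigma> k) (y (Suc k)) (z (Suc k)) (x k)") auto

  have close: "norm (x (Suc k) - w k) \<le> \<epsilon> k" for k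
  proof -
    have "(norm (x (Suc k) - w k))\<^sup>2 / (2 * \<sigma> k) \<le> (\<epsilon> k)\<^sup>2 / (2 * \<sigma> k)"
      using order_trans[OF augmented_Lagrangian_ge_prox[of p, of "w k" "b k", OF pw \<sigma>pos] stop'[of k]]
      unfolding F_def update r_def by simp
    then have "(norm (x (Suc k) - w k))\<^sup>2 \<le> (\<epsilon> k)\<^sup>2"
      using \<sigma>pos[of k] by (simp add: divide_le_cancel)
    then show ?thesis using \<epsilon>(1) by (rule power2_le_imp_le)
  qed
  \<comment> \<open>Add the gradient inequality of \<open>h\<close> at \<open>A *v w k\<close> to
    the subgradient inequality of \<open>p\<close>; the terms in \<open>dh\<close> and
    \<open>c\<close> cancel.\<close>
  have fsub: "ereal (F k + ((x k - w k) \<bullet> (u - w k)) / \<sigma> k) \<le> ?f u" for k u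
  proof -
    have "h (A *v w k) + dh (A *v w k) \<bullet> (A *v u - A *v w k) \<le> h (A *v u)"
      by (rule convex_on_above_gradient[OF assms(1) dh])
    then have "h (A *v w k) + (transpose A *v dh (A *v w k)) \<bullet> (u - w k) \<le> h (A *v u)"
      by (simp add: dot_lmul_matrix matrix_vector_mult_diff_distrib)
    then have "F k + ((x k - w k) \<bullet> (u - w k)) / \<sigma> k \<le> (h (A *v u) - c \<bullet> u)
        + (b k + (c - transpose A *v dh (A *v w k) + (1 / \<sigma> k) *\<^sub>R (x k - w k)) \<bullet> (u - w k))"
      unfolding F_def by (simp add: inner_add_left inner_diff_left inner_diff_right diff_divide_distrib)
    then show ?thesis
      using sub[of k u] unfolding primal_objective_def by (cases "p u") auto
  qed
  obtain l where l: "\<And>u. ?f l \<le> ?f u" "?f l = ereal (h (A *v x0) - c \<bullet> x0 + p0)" "x \<longlonglongrightarrow> l"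
    by (rule inexact_proximal_point_convergence[OF lsc fmin _ \<epsilon> \<sigma>0 \<sigma>ge close _ fsub])
       (auto simp: primal_objective_def p0 pw F_def)
  have primal: "primal_optimal h A c p l"
    using l(1,2) by (auto simp: primal_optimal_def optimal_solution_def is_arg_min_def not_less)

  \<comment> \<open>A dual solution built from the primal solution \<open>x0\<close>\<close>
  define ys where "ys = dh (A *v x0)"
  define zs where "zs = c - transpose A *v ys"
  have hys: "fenchel_conjugate (\<lambda>v. ereal (h v)) ys = ereal (ys \<bullet> (A *v x0) - h (A *v x0))"
    unfolding ys_def by (rule fenchel_conjugate_gradient[OF assms(1) dh])
  have "ereal (p0 - (transpose A *v dh (A *v x0) - c) \<bullet> (u - x0)) \<le> p u" for u
    using composite_minimizer_subgradient[OF assms(6) pninf p0 dphi] fmin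
    unfolding primal_objective_def by blast
  then have "ereal (p0 + zs \<bullet> (u - x0)) \<le> p u" for u
    by (simp add: zs_def ys_def inner_diff_left algebra_simps)
  then have pzs: "fenchel_conjugate p zs = ereal (zs \<bullet> x0 - p0)"
    by (intro fenchel_conjugate_at_subgradient[of p, OF p0])
  \<comment> \<open>The negative of the optimal primal value; the next lines show that it is the
    optimal dual value.\<close>
  define V where "V = c \<bullet> x0 - h (A *v x0) - p0"
  have V: "(ys \<bullet> (A *v x0) - h (A *v x0)) + (zs \<bullet> x0 - p0) = V"
    by (simp add: V_def zs_def inner_diff_left dot_lmul_matrix)
  have dual: "dual_optimal h A c p (ys, zs)"
  proof -
    have val: "dual_objective h p (ys, zs) = ereal V"
      using V by (simp add: dual_objective_def hys pzs)
    \<comment> \<open>Weak duality: add the Fenchel--Young inequalities at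
      \<open>x0\<close>.\<close>
    have "ereal V \<le> dual_objective h p (y', z')" if "transpose A *v y' + z' = c" for y' z'
    proof -
      have "(y' \<bullet> (A *v x0) - h (A *v x0)) + (z' \<bullet> x0 - p0) = V"
        unfolding V_def that[symmetric] by (simp add: inner_add_left dot_lmul_matrix)
      then show ?thesis
        using add_mono[OF fenchel_young[of "\<lambda>u. ereal (h u)" "A *v x0" "h (A *v x0)" y', OF refl]
            fenchel_young[of p x0 p0 z', OF p0]]
        by (simp add: dual_objective_def)
    qed
    then show ?thesis
      unfolding dual_optimal_def optimal_solution_def is_arg_min_def
      using val by (auto simp: zs_def not_less)
  qed

  \<comment> \<open>Convergence of the dual sequence\<close>
  have r0: "r \<longlonglongrightarrow> 0"
  proof -
    have "(\<lambda>k. x k - x (Suc k)) \<longlonglongrightarrow> 0"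
      using tendsto_diff[OF l(3) LIMSEQ_Suc[OF l(3)]] by simp
    then have lim: "(\<lambda>k. norm (x k - x (Suc k)) / \<sigma> 0) \<longlonglongrightarrow> 0"
      by (intro tendsto_divide_zero tendsto_norm_zero)
    have "norm (r k) \<le> norm (x k - x (Suc k)) / \<sigma> 0" for k
    proof -
      have "\<sigma> 0 * norm (r k) \<le> \<sigma> k * norm (r k)" by (intro mult_right_mono \<sigma>ge) simp
      also have "\<dots> = norm (x k - x (Suc k))" using \<sigma>pos[of k] by (simp add: update)
      finally show ?thesis using \<sigma>0 by (simp add: field_simps)
    qed
    then show ?thesis by (intro Lim_null_comparison[OF _ lim] always_eventually allI)
  qed
  \<comment> \<open>What remains of the Lagrangian estimate after Fenchel--Young for
    \<open>p\<close> at \<open>x0\<close>, with the nonnegative penalty term discarded.\<close>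
  define G where "G k = (\<epsilon> k)\<^sup>2 / (2 * \<sigma> 0) - r k \<bullet> x0 + x k \<bullet> r k" for k
  have G0: "G \<longlonglongrightarrow> 0"
    unfolding G_def using summable_LIMSEQ_zero[OF \<epsilon>(2)] r0 l(3) \<sigma>0
    by (auto intro!: tendsto_eq_intros)
  have gap: "fenchel_conjugate (\<lambda>v. ereal (h v)) (y (Suc k))
      \<le> ereal (y (Suc k) \<bullet> (A *v x0) - h (A *v x0) + G k)" for k
  proof -
    let ?hy = "fenchel_conjugate (\<lambda>v. ereal (h v)) (y (Suc k))"
    \<comment> \<open>The pair \<open>(ys, zs)\<close> is feasible, so its Lagrangian value is
      \<open>V\<close> for every \<open>k\<close>, which bounds all the infima.\<close>
    have "(INF (v, w). ?AL (\<sigma> k) v w (x k)) \<le> ?AL (\<sigma> k) ys zs (x k)"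
      by (rule INF_lower2[of "(ys, zs)"]) auto
    also have "\<dots> = ereal V"
      using V by (simp add: augmented_Lagrangian_def hys pzs) (simp add: zs_def)
    finally have "- F k - (norm (x k - w k))\<^sup>2 / (2 * \<sigma> k) \<le> V" unfolding inf by simp
    moreover have "(\<epsilon> k)\<^sup>2 / (2 * \<sigma> k) \<le> (\<epsilon> k)\<^sup>2 / (2 * \<sigma> 0)"
      using \<sigma>0 \<sigma>ge[of k] by (intro divide_left_mono) auto
    ultimately have AL: "?AL (\<sigma> k) (y (Suc k)) (z (Suc k)) (x k) \<le> ereal (V + (\<epsilon> k)\<^sup>2 / (2 * \<sigma> 0))"
      by (intro order_trans[OF stop'[of k]]) simp
    have "a \<le> y (Suc k) \<bullet> (A *v x0) - h (A *v x0) + G k" if "ereal a \<le> ?hy" for a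
    proof -
      have "a + (z (Suc k) \<bullet> x0 - p0) - x k \<bullet> r k + \<sigma> k / 2 * (norm (r k))\<^sup>2 \<le> V + (\<epsilon> k)\<^sup>2 / (2 * \<sigma> 0)"
        using order_trans[OF augmented_Lagrangian_ge[OF that
            fenchel_young[of p x0 p0 "z (Suc k)", OF p0]] AL]
        unfolding r_def by simp
      moreover have "0 \<le> \<sigma> k / 2 * (norm (r k))\<^sup>2" using \<sigma>pos[of k] by simp
      moreover have "r k \<bullet> x0 = y (Suc k) \<bullet> (A *v x0) + z (Suc k) \<bullet> x0 - c \<bullet> x0"
        by (simp add: r_def inner_add_left inner_diff_left dot_lmul_matrix)
      ultimately show ?thesis unfolding G_def V_def by linarith
    qed
    \<comment> \<open>The first instance settles a finite conjugate value; the second, one above the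
      bound, excludes an infinite one.\<close>
    from this[of "real_of_ereal ?hy"] this[of "y (Suc k) \<bullet> (A *v x0) - h (A *v x0) + G k + 1"]
    show ?thesis by (cases ?hy) auto
  qed
  have ySuc: "(\<lambda>k. y (Suc k)) \<longlonglongrightarrow> ys"
    unfolding ys_def by (rule fenchel_conjugate_gap_tendsto[OF dh gap G0])
  \<comment> \<open>By definition of the residual this sequence is \<open>z (Suc k)\<close>, so its
    limit follows from those of \<open>r\<close> and \<open>y\<close>.\<close>
  have "(\<lambda>k. c + r k - transpose A *v y (Suc k)) \<longlonglongrightarrow> c + 0 - transpose A *v ys"
    by (intro tendsto_intros r0 bounded_linear.tendsto[OF _ ySuc]) (rule matrix_vector_mul_bounded_linear)
  then have "(\<lambda>k. z (Suc k)) \<longlonglongrightarrow> zs" by (simp add: r_def zs_def)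
  then have "(\<lambda>k. (y k, z k)) \<longlonglongrightarrow> (ys, zs)"
    using ySuc by (intro tendsto_Pair) (rule LIMSEQ_imp_Suc, assumption)+
  then show ?thesis using primal l(3) dual by blast
qed

end
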